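(* Let $m,n\ge 1$ be integers and let $A,B \in \mathbb{R}^{m\times n}$ be given matrices. Suppose that $f:\mathbb{R}_+\to\mathbb{R}_+$ is a concave function satisfying $f(0)=0$. Then $$\sum_{i=1}^{\min\{m,n\}} \big| f(\sigma_i(A)) - f(\sigma_i(B)) \big| \le \sum_{i=1}^{\min\{m,n\}} f(\sigma_i(A-B)).$$
   Context: $\mathbb{R}_+=[0,\infty)$. For a real $m\times n$ matrix $Z$, $\sigma_i(Z)$ denotes its $i$-th largest singular value (counted with multiplicity), for $i=1,\ldots,\min\{m,n\}$. *)

theory Defs
  imports "HOL-Analysis.Convex" "Jordan_Normal_Form.Char_Poly"
begin

(* The singular values of an m x n matrix Z are the square roots of the min(m,n) largest eigenvalues
   of the n x n matrix Z^T Z; since Z^T Z has rank at most min(m,n), when m < n the remaining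
   n - m eigenvalues are zero.  As Z^T Z is real symmetric, its characteristic polynomial splits
   over the reals and the algebraic multiplicities counted by proots are the usual ones. *)
definition singular_values :: "real mat \<Rightarrow> real list" where
  "singular_values Z = take (min (dim_row Z) (dim_col Z))
     (rev (sorted_list_of_multiset (image_mset sqrt (proots (char_poly (transpose_mat Z * Z))))))"

(* Indexed from 1: meaningful for 1 \<le> i \<le> min(m,n). *)
definition singular_value :: "nat \<Rightarrow> real mat \<Rightarrow> real" where
  "singular_value i Z = singular_values Z ! (i - 1)"

end

theory Submission
  imports Defs
begin

text \<open>
  Write \<open>A - B\<close> as a sum of rank-one matrices \<open>w\<^sub>p v\<^sub>p\<^sup>T\<close> with \<open>\<bar>w\<^sub>p\<bar> = \<sigma>\<^sub>p(A - B)\<close> and \<open>\<bar>v\<^sub>p\<bar> = 1\<close>, and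
  walk from \<open>B\<close> to \<open>A\<close> adding one of them at a time. By the triangle inequality it suffices
  that adding \<open>w v\<^sup>T\<close> with \<open>\<bar>w\<bar> = s\<close>, \<open>\<bar>v\<bar> = 1\<close> changes the list of values \<open>f(\<sigma>\<^sub>i)\<close> by at most \<open>f(s)\<close> in
  \<open>\<ell>\<^sub>1\<close>. On the dilation \<open>[0, X; X\<^sup>T, 0]\<close>, whose eigenvalues are \<open>\<plusminus>\<sigma>\<^sub>i\<close> and zeros, such a step is
  \<open>a a\<^sup>T - b b\<^sup>T\<close> with \<open>\<bar>a\<bar>\<^sup>2 = \<bar>b\<bar>\<^sup>2 = s\<close>. Hence the old and new singular values interlace, and Weyl
  monotonicity together with the trace gives \<open>\<Sum>\<^sub>i \<bar>\<sigma>\<^sub>i - \<sigma>\<^sub>i'\<bar> \<le> s\<close>. So the intervals between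
  \<open>\<sigma>\<^sub>i\<close> and \<open>\<sigma>\<^sub>i'\<close> do not overlap and have total length at most \<open>s\<close>; concavity does the rest.
\<close>

unbundle no inner_syntax

subsection \<open>Diagonalization of real symmetric matrices\<close>

text \<open>Padded with zero vectors, \<open>cs\<close> becomes the rows of a square matrix
  \<open>M\<close> whose last row is zero. So its transpose kills the last unit vector,
  \<open>det M = 0\<close>, and any nonzero kernel vector of \<open>M\<close> serves.\<close>

lemma exists_nonzero_orthogonal_vec:
  fixes cs :: "'a :: field vec list"
  assumes cs: "set cs \<subseteq> carrier_vec n" and len: "length cs < n"
  shows "\<exists>x \<in> carrier_vec n. x \<noteq> 0\<^sub>v n \<and> (\<forall>c \<in> set cs. c \<bullet> x = 0)"
proof -
  define ds where "ds = cs @ replicate (n - length cs) (0\<^sub>v n)"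
  define M where "M = mat_of_rows n ds"
  have lds: "length ds = n" using len by (simp add: ds_def)
  have M: "M \<in> carrier_mat n n" using mat_of_rows_carrier(1)[of n ds] by (simp add: M_def lds)
  have dc: "ds ! i \<in> carrier_vec n" if "i < n" for i
    using that cs len by (auto simp: ds_def nth_append)
  have "transpose_mat M *\<^sub>v unit_vec n (n - 1) = 0\<^sub>v n"
    using len M by (intro eq_vecI) (auto simp: M_def ds_def mat_of_rows_def nth_append)
  moreover have "unit_vec n (n - 1) \<noteq> (0\<^sub>v n :: 'a vec)"
    using len by (auto simp: unit_vec_def vec_eq_iff)
  ultimately have "det (transpose_mat M) = 0"
    using M by (subst det_0_iff_vec_prod_zero_field[of _ n])
      (auto intro!: exI[of _ "unit_vec n (n - 1)"])
  hence "det M = 0" using det_transpose[OF M] by simp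
  then obtain x where x: "x \<in> carrier_vec n" "x \<noteq> 0\<^sub>v n" "M *\<^sub>v x = 0\<^sub>v n"
    using det_0_iff_vec_prod_zero_field[OF M] by auto
  have "c \<bullet> x = 0" if c: "c \<in> set cs" for c
  proof -
    obtain i where i: "i < length cs" "cs ! i = c" using c by (auto simp: in_set_conv_nth)
    have "row M i = c" unfolding M_def using i len dc[of i] lds
      by (subst mat_of_rows_row) (auto simp: ds_def nth_append)
    moreover have "(M *\<^sub>v x) $ i = 0" using x i len by simp
    ultimately show ?thesis using i len M by simp
  qed
  thus ?thesis using x by blast
qed

text \<open>Over the complex numbers the polynomial splits. Each root is an eigenvalue of a real
  symmetric matrix, hence real, so the factorization descends to the reals.\<close>

lemma symmetric_char_poly_splits:
  fixes S :: "real mat"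
  assumes S: "S \<in> carrier_mat n n" and sym: "transpose_mat S = S"
  shows "\<exists>es. length es = n \<and> sorted_wrt (\<ge>) es \<and> char_poly S = (\<Prod>e\<leftarrow>es. [:- e, 1:])"
proof -
  let ?C = "map_mat complex_of_real S"
  have C: "?C \<in> carrier_mat n n" using S by simp
  obtain as where as: "char_poly ?C = (\<Prod>a\<leftarrow>as. [:- a, 1:])" "length as = n"
    using char_poly_factorized[OF C] by blast
  have real: "complex_of_real (Re a) = a" if a: "a \<in> set as" for a
  proof -
    have "poly (char_poly ?C) a = 0"
      unfolding as poly_prod_list prod_list_zero_iff using a by force
    then obtain v where "eigenvector ?C v a"
      using eigenvalue_root_char_poly[OF C] by (auto simp: eigenvalue_def)
    hence v: "v \<in> carrier_vec n" "v \<noteq> 0\<^sub>v n" "?C *\<^sub>v v = a \<cdot>\<^sub>v v"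
      using S by (auto simp: eigenvector_def)
    have Ct: "transpose_mat ?C = ?C" by (simp add: map_mat_transpose sym)
    have conj: "conjugate (?C *\<^sub>v v) = ?C *\<^sub>v conjugate v"
      using S v(1) by (intro eq_vecI) (auto simp: scalar_prod_def sum_conjugate conjugate_dist_mul)
    \<comment> \<open>Moving the matrix across the inner product gives
      \<open>a |v|^2 = cnj a |v|^2\<close>, with \<open>|v|^2\<close> nonzero.\<close>
    have "a * (v \<bullet>c v) = (?C *\<^sub>v v) \<bullet>c v" using v by simp
    also have "\<dots> = v \<bullet> (?C *\<^sub>v conjugate v)"
    proof -
      have "(?C *\<^sub>v v) \<bullet>c v = (transpose_mat ?C *\<^sub>v v) \<bullet> conjugate v" by (simp add: Ct)
      also have "\<dots> = v \<bullet> (?C *\<^sub>v conjugate v)"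
        using transpose_vec_mult_scalar[OF C, of "conjugate v" v] v by simp
      finally show ?thesis .
    qed
    also have "\<dots> = v \<bullet>c (a \<cdot>\<^sub>v v)" by (simp add: conj[symmetric] v)
    also have "\<dots> = cnj a * (v \<bullet>c v)" using v by (simp add: conjugate_smult_vec)
    finally have "a = cnj a" using v conjugate_square_eq_0_vec[of v n] by simp
    thus ?thesis by (metis Reals_cnj_iff of_real_Re)
  qed
  define es where "es = rev (sort (map Re as))"
  interpret hp: map_poly_inj_idom_hom complex_of_real ..
  have "map_poly complex_of_real (char_poly S) = char_poly ?C"
    by (rule of_real_hom.char_poly_hom[symmetric, OF S])
  also have "\<dots> = (\<Prod>a\<leftarrow>as. map_poly complex_of_real [:- Re a, 1:])"
    unfolding as by (rule arg_cong[where f = prod_list], rule map_cong) (auto simp: real)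
  also have "\<dots> = (\<Prod>e\<leftarrow>map Re as. map_poly complex_of_real [:- e, 1:])"
    by (simp add: o_def)
  also have "\<dots> = (\<Prod>e\<leftarrow>es. map_poly complex_of_real [:- e, 1:])"
    by (simp only: prod_mset_prod_list[symmetric] mset_map es_def mset_rev mset_sort)
  also have "\<dots> = map_poly complex_of_real (\<Prod>e\<leftarrow>es. [:- e, 1:])"
    by (simp add: hp.hom_prod_list o_def)
  finally have "char_poly S = (\<Prod>e\<leftarrow>es. [:- e, 1:])"
    by simp
  moreover have "length es = n" "sorted_wrt (\<ge>) es"
    by (simp_all add: es_def as sorted_wrt_rev)
  ultimately show ?thesis by blast
qed

text \<open>The Householder reflection \<open>I - c w w^T\<close> with \<open>w = v - e_0\<close>
  swaps the unit vectors \<open>v\<close> and \<open>e_0\<close>.\<close>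

lemma exists_reflection_with_first_column:
  fixes v :: "real vec"
  assumes v: "v \<in> carrier_vec n" "v \<bullet> v = 1" and n: "0 < n"
  shows "\<exists>H \<in> carrier_mat n n. transpose_mat H = H \<and> H * H = 1\<^sub>m n \<and> H *\<^sub>v unit_vec n 0 = v"
proof -
  define w where "w i = v $ i - (if i = 0 then 1 else 0)" for i
  define q where "q = (\<Sum>i<n. w i * w i)"
  \<comment> \<open>If \<open>v = e_0\<close>, then \<open>q = 0\<close>, and
    \<open>2 / 0 = 0\<close> turns \<open>H\<close> into the identity, as it should be.\<close>
  define c where "c = 2 / q"
  define H where "H = mat n n (\<lambda>(i, j). (if i = j then 1 else 0) - c * w i * w j)"
  have H: "H \<in> carrier_mat n n" by (simp add: H_def)
  have "q = (\<Sum>i<n. v $ i * v $ i) - 2 * v $ 0 + 1"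
  proof -
    have "q = (\<Sum>i<n. v $ i * v $ i - (if i = 0 then 2 * v $ i - 1 else 0))"
      unfolding q_def w_def by (rule sum.cong) (auto simp: algebra_simps)
    thus ?thesis using n by (simp add: sum_subtractf)
  qed
  hence q: "q = 2 - 2 * v $ 0"
    using v by (simp add: scalar_prod_def atLeast0LessThan)
  have w0: "w i = 0" if "q = 0" "i < n" for i
  proof -
    have "w i * w i = 0" using that
      unfolding q_def by (subst (asm) sum_nonneg_eq_0_iff) auto
    thus ?thesis by simp
  qed
  have cq: "c * c * q = 2 * c" by (simp add: c_def)
  have "H * H = 1\<^sub>m n"
  proof (rule eq_matI)
    fix i j assume "i < dim_row (1\<^sub>m n :: real mat)" "j < dim_col (1\<^sub>m n :: real mat)"
    hence ij: "i < n" "j < n" by auto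
    have "(\<Sum>k<n. ((if i = k then 1 else 0) - c * w i * w k) * ((if k = j then 1 else 0) - c * w k * w j))
      = (\<Sum>k<n. (if k = i then (if k = j then 1 else 0) - c * w i * w j else 0)
           - (if k = j then c * w i * w j else 0) + c * c * w i * w j * (w k * w k))"
      by (rule sum.cong) (auto simp: algebra_simps)
    also have "\<dots> = (if i = j then 1 else 0) - 2 * c * w i * w j + (c * c * q) * w i * w j"
      using ij by (simp add: sum.distrib sum_subtractf sum_distrib_left[symmetric] q_def[symmetric])
    finally show "(H * H) $$ (i, j) = 1\<^sub>m n $$ (i, j)"
      using ij cq by (simp add: H_def scalar_prod_def atLeast0LessThan)
  qed (simp_all add: H_def)
  moreover have "H *\<^sub>v unit_vec n 0 = v"
  proof (rule eq_vecI)
    fix i assume "i < dim_vec v"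
    hence i: "i < n" using v by simp
    have "c * w i * w 0 = - w i"
    proof (cases "q = 0")
      case False
      have "w 0 = - q / 2" using q by (simp add: w_def)
      thus ?thesis using False by (simp add: c_def)
    qed (use w0 i in auto)
    thus "(H *\<^sub>v unit_vec n 0) $ i = v $ i"
      using i n by (simp add: H_def w_def)
  qed (use v in \<open>simp add: H_def\<close>)
  moreover have "transpose_mat H = H" by (rule eq_matI) (auto simp: H_def)
  ultimately show ?thesis using H by blast
qed

definition diagonalizes :: "nat \<Rightarrow> real mat \<Rightarrow> real list \<Rightarrow> real mat \<Rightarrow> bool" where
  "diagonalizes n Q es S \<longleftrightarrow> Q \<in> carrier_mat n n \<and> length es = n \<and>
     Q * transpose_mat Q = 1\<^sub>m n \<and> transpose_mat Q * Q = 1\<^sub>m n \<and>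
     S = Q * mat_diag n (\<lambda>i. es ! i) * transpose_mat Q"

text \<open>Deflation, by induction on the list. A reflection carries a unit eigenvector for
  \<open>e\<close> to \<open>e_0\<close>; by symmetry the conjugated matrix splits into the block
  \<open>e\<close> and a symmetric block \<open>S'\<close> whose characteristic polynomial has one
  factor less. Since \<open>es\<close> is given beforehand, the order of the eigenvalues can be
  chosen by the caller.\<close>

lemma symmetric_diagonalizable:
  assumes "S \<in> carrier_mat n n" and "transpose_mat S = S"
    and "char_poly S = (\<Prod>e\<leftarrow>es. [:- e, 1:])" and "length es = n"
  shows "\<exists>Q. diagonalizes n Q es S"
  using assms
proof (induction es arbitrary: n S)
  case Nil
  hence "diagonalizes n (1\<^sub>m 0) [] S" by (auto simp: diagonalizes_def intro!: eq_matI)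
  thus ?case ..
next
  case (Cons e es m)
  define n where "n = length es"
  have m: "m = Suc n" using Cons.prems by (simp add: n_def)
  note S = Cons.prems(1) and sym = Cons.prems(2)
  have "poly (char_poly S) e = 0" by (simp add: Cons.prems)
  then obtain u where "eigenvector S u e"
    using eigenvalue_root_char_poly[OF S] by (auto simp: eigenvalue_def)
  hence u: "u \<in> carrier_vec m" "u \<noteq> 0\<^sub>v m" "S *\<^sub>v u = e \<cdot>\<^sub>v u"
    using S by (auto simp: eigenvector_def)
  have uu: "u \<bullet> u > 0" using conjugate_square_greater_0_vec[OF u(1)] u(2) by simp
  define v where "v = (1 / sqrt (u \<bullet> u)) \<cdot>\<^sub>v u"
  have v: "v \<in> carrier_vec m" using u by (simp add: v_def)
  have vv: "v \<bullet> v = 1" using u uu by (simp add: v_def)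
  have Sv: "S *\<^sub>v v = e \<cdot>\<^sub>v v"
    using u S by (simp add: v_def mult_mat_vec[of _ m m] smult_smult_assoc mult.commute)
  obtain H where H: "H \<in> carrier_mat m m" and Ht: "transpose_mat H = H" and HH: "H * H = 1\<^sub>m m"
    and Hv: "H *\<^sub>v unit_vec m 0 = v"
    using exists_reflection_with_first_column[OF v vv] m by auto
  define B where "B = H * S * H"
  have B: "B \<in> carrier_mat m m" using H S by (simp add: B_def)
  have Bt: "transpose_mat B = B"
    using H S Ht sym by (simp add: B_def transpose_mult[of _ m m _ m] assoc_mult_mat[of _ m m _ m _ m])
  have SB: "S = H * B * H"
  proof -
    have "H * B * H = (H * H) * S * (H * H)"
      using H S by (simp add: B_def assoc_mult_mat[of _ m m _ m _ m])
    thus ?thesis using S by (simp add: HH)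
  qed
  \<comment> \<open>\<open>H\<close> is an involution with \<open>H e_0 = v\<close>, so
    \<open>e_0\<close> is an eigenvector of \<open>B = H S H\<close>.\<close>
  have "B *\<^sub>v unit_vec m 0 = H *\<^sub>v (S *\<^sub>v (H *\<^sub>v unit_vec m 0))"
    using H S by (simp add: B_def assoc_mult_mat_vec[of _ m m _ m])
  also have "\<dots> = e \<cdot>\<^sub>v (H *\<^sub>v (H *\<^sub>v unit_vec m 0))"
    unfolding Hv Sv using H v by (simp add: mult_mat_vec[of _ m m])
  also have "\<dots> = e \<cdot>\<^sub>v unit_vec m 0"
    using H by (subst assoc_mult_mat_vec[symmetric, of _ m m _ m]) (auto simp: HH)
  finally have Be: "B *\<^sub>v unit_vec m 0 = e \<cdot>\<^sub>v unit_vec m 0" .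
  have B0: "B $$ (i, 0) = (if i = 0 then e else 0)" if "i < m" for i
    using arg_cong[OF Be, of "\<lambda>w. w $ i"] that B m by simp
  have B0': "B $$ (0, i) = (if i = 0 then e else 0)" if "i < m" for i
    using B0[OF that] arg_cong[OF Bt, of "\<lambda>w. w $$ (i, 0)"] that B m by simp
  define S' where "S' = mat n n (\<lambda>(i, j). B $$ (Suc i, Suc j))"
  have S': "S' \<in> carrier_mat n n" by (simp add: S'_def)
  let ?e = "mat 1 1 (\<lambda>_. e)"
  have Bblock: "B = four_block_mat ?e (0\<^sub>m 1 n) (0\<^sub>m n 1) S'"
    by (rule eq_matI) (use B m B0 B0' in \<open>auto simp: S'_def\<close>)
  have "transpose_mat S' = S'"
  proof (rule eq_matI)
    fix i j assume "i < dim_row S'" "j < dim_col S'"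
    thus "transpose_mat S' $$ (i, j) = S' $$ (i, j)"
      using arg_cong[OF Bt, of "\<lambda>w. w $$ (Suc i, Suc j)"] B m by (simp add: S'_def)
  qed (auto simp: S'_def)
  moreover have "char_poly S' = (\<Prod>e\<leftarrow>es. [:- e, 1:])"
  proof -
    have "similar_mat S B"
      unfolding similar_mat_def similar_mat_wit_def
      by (rule exI[of _ H], rule exI[of _ H]) (use S B H HH SB in \<open>auto simp: Let_def\<close>)
    hence "char_poly S = char_poly B" by (rule char_poly_similar)
    also have "\<dots> = char_poly ?e * char_poly S'"
      unfolding Bblock by (rule char_poly_four_block_zeros_col[OF _ _ S']) auto
    also have "char_poly ?e = [:- e, 1:]"
      by (subst char_poly_upper_triangular[of _ 1]) (auto simp: diag_mat_def upper_triangular_def)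
    finally have "[:- e, 1:] * char_poly S' = [:- e, 1:] * (\<Prod>e\<leftarrow>es. [:- e, 1:])"
      using Cons.prems(3) by simp
    thus ?thesis by (subst (asm) mult_left_cancel) auto
  qed
  ultimately obtain Q' where Q': "diagonalizes n Q' es S'"
    using Cons.IH[OF S'] n_def by auto
  hence Qc: "Q' \<in> carrier_mat n n" and QQ: "Q' * transpose_mat Q' = 1\<^sub>m n"
    "transpose_mat Q' * Q' = 1\<^sub>m n"
    and SQ: "S' = Q' * mat_diag n (\<lambda>i. es ! i) * transpose_mat Q'"
    by (auto simp: diagonalizes_def)
  let ?blk = "\<lambda>a M. four_block_mat a (0\<^sub>m 1 n) (0\<^sub>m n 1) M"
  have blk_mult: "?blk a M * ?blk b N = ?blk (a * b) (M * N)"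
    if "a \<in> carrier_mat 1 1" "b \<in> carrier_mat 1 1" "M \<in> carrier_mat n n" "N \<in> carrier_mat n n"
    for a b M N :: "real mat"
    using that by (subst mult_four_block_mat[of _ 1 1 _ n _ n _ _ 1 _ n]) auto
  have blk_c: "?blk a M \<in> carrier_mat m m" if "a \<in> carrier_mat 1 1" "M \<in> carrier_mat n n"
    for a M :: "real mat" using that four_block_carrier_mat[OF that] m by simp
  \<comment> \<open>Bordering \<open>Q'\<close> by a 1 diagonalizes \<open>B\<close>; then
    \<open>H * K\<close> diagonalizes \<open>S\<close>.\<close>
  define K where "K = ?blk (1\<^sub>m 1) Q'"
  have K: "K \<in> carrier_mat m m" unfolding K_def by (rule blk_c) (use Qc in auto)
  have Kt: "transpose_mat K = ?blk (1\<^sub>m 1) (transpose_mat Q')"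
    unfolding K_def using Qc by (subst transpose_four_block_mat[of _ 1 1 _ n _ n]) auto
  have one: "?blk (1\<^sub>m 1) (1\<^sub>m n) = (1\<^sub>m m :: real mat)" using m by simp
  have KK: "K * transpose_mat K = 1\<^sub>m m" "transpose_mat K * K = 1\<^sub>m m"
    unfolding Kt unfolding K_def using Qc QQ one by (simp_all add: blk_mult del: One_nat_def)
  have D: "mat_diag m (\<lambda>i. (e # es) ! i) = ?blk ?e (mat_diag n (\<lambda>i. es ! i))"
    by (rule eq_matI) (auto simp: mat_diag_def m nth_Cons')
  have "B = K * mat_diag m (\<lambda>i. (e # es) ! i) * transpose_mat K"
    unfolding D Kt unfolding K_def Bblock SQ using Qc by (simp add: blk_mult del: One_nat_def)
  hence "S = (H * K) * mat_diag m (\<lambda>i. (e # es) ! i) * transpose_mat (H * K)"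
    using H K SB Ht
    by (simp add: transpose_mult[of _ m m _ m] assoc_mult_mat[of _ m m _ m _ m] mult_carrier_mat[of _ m m _ m])
  moreover have "(H * K) * transpose_mat (H * K) = 1\<^sub>m m"
  proof -
    have "(H * K) * transpose_mat (H * K) = H * (K * transpose_mat K) * H"
      using H K Ht by (simp add: transpose_mult[of _ m m _ m] assoc_mult_mat[of _ m m _ m _ m])
    thus ?thesis using H HH KK by simp
  qed
  moreover have "transpose_mat (H * K) * (H * K) = 1\<^sub>m m"
  proof -
    have "transpose_mat (H * K) * (H * K) = transpose_mat K * (H * H) * K"
      using H K Ht by (simp add: transpose_mult[of _ m m _ m] assoc_mult_mat[of _ m m _ m _ m])
    thus ?thesis using K HH KK by simp
  qed
  ultimately have "diagonalizes m (H * K) (e # es) S"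
    unfolding diagonalizes_def using H K m n_def by simp
  thus ?case ..
qed

subsection \<open>Perturbation of eigenvalues\<close>

text \<open>\<open>Q^T x\<close> is the coordinate vector of \<open>x\<close> in an orthonormal
  eigenbasis, where the form is diagonal and the norm is unchanged.\<close>

lemma diagonalizes_sum_squares:
  assumes "diagonalizes n Q es S" and x: "x \<in> carrier_vec n"
  shows "x \<bullet> (S *\<^sub>v x) = (\<Sum>i<n. es ! i * (col Q i \<bullet> x)\<^sup>2)"
    and "x \<bullet> x = (\<Sum>i<n. (col Q i \<bullet> x)\<^sup>2)"
proof -
  let ?D = "mat_diag n (\<lambda>i. es ! i)"
  have Q: "Q \<in> carrier_mat n n" and QQ: "Q * transpose_mat Q = 1\<^sub>m n"
    and S: "S = Q * ?D * transpose_mat Q"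
    using assms by (auto simp: diagonalizes_def)
  define c where "c = transpose_mat Q *\<^sub>v x"
  have c: "c \<in> carrier_vec n"
    unfolding c_def by (rule mult_mat_vec_carrier[of _ n n]) (use Q x in auto)
  have ci: "c $ i = col Q i \<bullet> x" if "i < n" for i using that Q x by (simp add: c_def)
  have move: "x \<bullet> (Q *\<^sub>v y) = c \<bullet> y" if "y \<in> carrier_vec n" for y
    using transpose_vec_mult_scalar[OF Q that x] c_def by simp
  have "x \<bullet> (S *\<^sub>v x) = c \<bullet> (?D *\<^sub>v c)"
    unfolding S using Q x c by (simp add: assoc_mult_mat_vec[of _ n n _ n] mult_carrier_mat[of _ n n _ n]
        mult_mat_vec_carrier[of _ n n] move c_def[symmetric])
  also have "\<dots> = (\<Sum>i<n. es ! i * (c $ i)\<^sup>2)"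
  proof -
    have "(?D *\<^sub>v c) $ i = es ! i * c $ i" if i: "i < n" for i
    proof -
      have "(?D *\<^sub>v c) $ i = (\<Sum>j<n. (if i = j then es ! j else 0) * c $ j)"
        using i c by (simp add: mat_diag_def scalar_prod_def atLeast0LessThan)
      also have "\<dots> = (\<Sum>j<n. if j = i then es ! i * c $ i else 0)"
        by (rule sum.cong) auto
      finally show ?thesis using i by simp
    qed
    thus ?thesis using c
      by (auto simp: scalar_prod_def atLeast0LessThan power2_eq_square mult_ac
          mat_diag_def intro!: sum.cong)
  qed
  finally show "x \<bullet> (S *\<^sub>v x) = (\<Sum>i<n. es ! i * (col Q i \<bullet> x)\<^sup>2)" by (simp add: ci)
  have "x = Q *\<^sub>v c"
    using Q x by (simp add: c_def assoc_mult_mat_vec[symmetric, of _ n n _ n] QQ)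
  hence "x \<bullet> x = c \<bullet> c" using move[OF c] by simp
  thus "x \<bullet> x = (\<Sum>i<n. (col Q i \<bullet> x)\<^sup>2)"
    using c by (simp add: scalar_prod_def atLeast0LessThan ci power2_eq_square)
qed

text \<open>The Courant--Fischer dimension count: the eigenvectors \<open>i + r + 1, \<dots>\<close> of \<open>M\<close>, the
  \<open>r\<close> constraints and the first \<open>i\<close> eigenvectors of \<open>N\<close> are only \<open>n - 1\<close> vectors.\<close>

lemma eigenvalue_le_of_constrained_form_le:
  assumes M: "diagonalizes n P ds M" "sorted_wrt (\<ge>) ds"
    and N: "diagonalizes n Q es N" "sorted_wrt (\<ge>) es"
    and ws: "set ws \<subseteq> carrier_vec n"
    and le: "\<And>x. x \<in> carrier_vec n \<Longrightarrow> \<forall>w \<in> set ws. w \<bullet> x = 0 \<Longrightarrow> x \<bullet> (M *\<^sub>v x) \<le> x \<bullet> (N *\<^sub>v x)"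
    and i: "i + length ws < n"
  shows "ds ! (i + length ws) \<le> es ! i"
proof -
  define k where "k = i + length ws"
  define cs where "cs = map (col P) [Suc k..<n] @ ws @ map (col Q) [0..<i]"
  have "set cs \<subseteq> carrier_vec n"
    using ws M(1) N(1) i by (auto simp: cs_def diagonalizes_def intro!: col_carrier_vec[of _ n])
  moreover have "length cs < n" using i by (simp add: cs_def k_def)
  ultimately obtain x where x: "x \<in> carrier_vec n" "x \<noteq> 0\<^sub>v n"
    and 0: "\<And>c. c \<in> set cs \<Longrightarrow> c \<bullet> x = 0"
    using exists_nonzero_orthogonal_vec by blast
  have P0: "col P j \<bullet> x = 0" if "k < j" "j < n" for j using that by (intro 0) (auto simp: cs_def)
  have Q0: "col Q j \<bullet> x = 0" if "j < i" for j using that by (intro 0) (auto simp: cs_def)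
  have lens: "length ds = n" "length es = n" using M N by (auto simp: diagonalizes_def)
  have xx: "x \<bullet> x > 0" using conjugate_square_greater_0_vec[OF x(1)] x(2) by simp
  \<comment> \<open>\<open>x\<close> has no component past index \<open>k\<close> in the eigenbasis
    \<open>P\<close> and none before \<open>i\<close> in \<open>Q\<close>. So its
    \<open>M\<close>-form is at least \<open>ds ! k\<close> times \<open>|x|^2\<close> and its
    \<open>N\<close>-form at most \<open>es ! i\<close> times \<open>|x|^2\<close>.\<close>
  have "ds ! k * (x \<bullet> x) = (\<Sum>j<n. ds ! k * (col P j \<bullet> x)\<^sup>2)"
    by (simp add: diagonalizes_sum_squares(2)[OF M(1) x(1)] sum_distrib_left)
  also have "\<dots> \<le> (\<Sum>j<n. ds ! j * (col P j \<bullet> x)\<^sup>2)"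
  proof (rule sum_mono)
    fix j assume j: "j \<in> {..<n}"
    show "ds ! k * (col P j \<bullet> x)\<^sup>2 \<le> ds ! j * (col P j \<bullet> x)\<^sup>2"
    proof (cases "k < j")
      case False
      hence "ds ! k \<le> ds ! j"
        using i j lens M(2) by (cases "j = k") (auto simp: sorted_wrt_iff_nth_less k_def)
      thus ?thesis by (simp add: mult_right_mono)
    qed (use P0 j in auto)
  qed
  also have "\<dots> \<le> (\<Sum>j<n. es ! j * (col Q j \<bullet> x)\<^sup>2)"
    using le[OF x(1)] 0
    by (simp add: cs_def diagonalizes_sum_squares(1)[OF M(1) x(1)] diagonalizes_sum_squares(1)[OF N(1) x(1)])
  also have "\<dots> \<le> (\<Sum>j<n. es ! i * (col Q j \<bullet> x)\<^sup>2)"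
  proof (rule sum_mono)
    fix j assume j: "j \<in> {..<n}"
    show "es ! j * (col Q j \<bullet> x)\<^sup>2 \<le> es ! i * (col Q j \<bullet> x)\<^sup>2"
    proof (cases "j < i")
      case False
      hence "es ! j \<le> es ! i"
        using i j lens N(2) by (cases "j = i") (auto simp: sorted_wrt_iff_nth_less)
      thus ?thesis by (simp add: mult_right_mono)
    qed (use Q0 in auto)
  qed
  also have "\<dots> = es ! i * (x \<bullet> x)"
    by (simp add: diagonalizes_sum_squares(2)[OF N(1) x(1)] sum_distrib_left)
  finally show ?thesis using xx by (simp add: k_def)
qed

lemma diagonalizes_trace:
  assumes "diagonalizes n Q es S"
  shows "(\<Sum>i<n. S $$ (i, i)) = (\<Sum>i<n. es ! i)"
proof -
  have Q: "Q \<in> carrier_mat n n" and QQ: "transpose_mat Q * Q = 1\<^sub>m n"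
    and S: "S = Q * mat_diag n (\<lambda>i. es ! i) * transpose_mat Q"
    using assms by (auto simp: diagonalizes_def)
  have "(\<Sum>i<n. S $$ (i, i)) = (\<Sum>i<n. \<Sum>j<n. es ! j * (Q $$ (i, j) * Q $$ (i, j)))"
    unfolding S mat_diag_mult_right[OF Q] using Q
    by (auto simp: scalar_prod_def atLeast0LessThan mult_ac intro!: sum.cong)
  also have "\<dots> = (\<Sum>j<n. es ! j * (\<Sum>i<n. Q $$ (i, j) * Q $$ (i, j)))"
    by (subst sum.swap) (simp add: sum_distrib_left)
  also have "\<dots> = (\<Sum>j<n. es ! j)"
  proof (rule sum.cong)
    fix j assume "j \<in> {..<n}"
    thus "es ! j * (\<Sum>i<n. Q $$ (i, j) * Q $$ (i, j)) = es ! j"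
      using arg_cong[OF QQ, of "\<lambda>M. M $$ (j, j)"] Q
      by (simp add: scalar_prod_def atLeast0LessThan)
  qed simp
  finally show ?thesis .
qed

lemma diagonalizes_symmetric:
  assumes "diagonalizes n Q es S"
  shows "S \<in> carrier_mat n n" and "transpose_mat S = S"
proof -
  let ?D = "mat_diag n (\<lambda>i. es ! i)"
  have Q: "Q \<in> carrier_mat n n" and S: "S = Q * ?D * transpose_mat Q"
    using assms by (auto simp: diagonalizes_def)
  show "S \<in> carrier_mat n n" unfolding S using Q by (intro mult_carrier_mat[of _ n n]) auto
  have "transpose_mat ?D = ?D" by (rule eq_matI) (auto simp: mat_diag_def)
  moreover have "transpose_mat S = transpose_mat (transpose_mat Q) * (transpose_mat ?D * transpose_mat Q)"
    unfolding S using Q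
    by (subst transpose_mult[of _ n n _ n]) (auto simp: transpose_mult[of _ n n _ n])
  ultimately show "transpose_mat S = S"
    unfolding S using Q by (simp add: assoc_mult_mat[of _ n n _ n _ n])
qed

section \<open>Rank-one updates and interlacing of eigenvalues\<close>

definition outer_prod :: "real vec \<Rightarrow> real vec \<Rightarrow> real mat" where
  "outer_prod u v = mat (dim_vec u) (dim_vec v) (\<lambda>(i, j). u $ i * v $ j)"

lemma outer_prod_carrier [simp]:
  "u \<in> carrier_vec m \<Longrightarrow> v \<in> carrier_vec n \<Longrightarrow> outer_prod u v \<in> carrier_mat m n"
  by (simp add: outer_prod_def)

lemma outer_prod_form:
  assumes "a \<in> carrier_vec n" "x \<in> carrier_vec n"
  shows "x \<bullet> (outer_prod a a *\<^sub>v x) = (a \<bullet> x)\<^sup>2"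
proof -
  have "outer_prod a a *\<^sub>v x = (a \<bullet> x) \<cdot>\<^sub>v a"
    using assms by (intro eq_vecI) (auto simp: outer_prod_def scalar_prod_def sum_distrib_left mult_ac)
  thus ?thesis using assms comm_scalar_prod[of a n x] by (simp add: power2_eq_square)
qed

lemma form_add_outer_prod:
  assumes "M \<in> carrier_mat n n" "a \<in> carrier_vec n" "x \<in> carrier_vec n"
  shows "x \<bullet> ((M + outer_prod a a) *\<^sub>v x) = x \<bullet> (M *\<^sub>v x) + (a \<bullet> x)\<^sup>2"
proof -
  have "M *\<^sub>v x \<in> carrier_vec n" "outer_prod a a *\<^sub>v x \<in> carrier_vec n"
    using assms by (auto intro!: mult_mat_vec_carrier[of _ n n])
  thus ?thesis
    using assms by (simp add: add_mult_distrib_mat_vec[of _ n n] scalar_prod_add_distrib[of _ n]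
        outer_prod_form)
qed

text \<open>Weyl monotonicity is the comparison of forms with an empty list of constraints; the
  total increase is the trace of \<open>a a^T\<close>.\<close>

lemma eigenvalues_add_outer_prod:
  assumes M: "diagonalizes n P ds M" "sorted_wrt (\<ge>) ds"
    and N: "diagonalizes n Q es (M + outer_prod a a)" "sorted_wrt (\<ge>) es"
    and a: "a \<in> carrier_vec n"
  shows "\<And>i. i < n \<Longrightarrow> ds ! i \<le> es ! i" and "(\<Sum>i<n. es ! i - ds ! i) = a \<bullet> a"
proof -
  note Mc = diagonalizes_symmetric(1)[OF M(1)]
  show "ds ! i \<le> es ! i" if "i < n" for i
    using eigenvalue_le_of_constrained_form_le[OF M N, of "[]" i] that Mc a
    by (simp add: form_add_outer_prod)
  show "(\<Sum>i<n. es ! i - ds ! i) = a \<bullet> a"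
    using a Mc by (simp add: sum_subtractf diagonalizes_trace[OF M(1), symmetric]
        diagonalizes_trace[OF N(1), symmetric] sum.distrib outer_prod_def scalar_prod_def
        atLeast0LessThan)
qed

text \<open>\<open>M\<close> and \<open>N\<close> both lie below the common matrix
  \<open>K = M + a a^T = N + b b^T\<close>. Passing through the eigenvalues \<open>fs\<close> of
  \<open>K\<close> costs \<open>|a|^2\<close> on one side and \<open>|b|^2\<close> on the
  other.\<close>

lemma eigenvalues_signed_rank_two_perturbation:
  assumes M: "diagonalizes n P ds M" "sorted_wrt (\<ge>) ds"
    and N: "diagonalizes n Q es N" "sorted_wrt (\<ge>) es"
    and a: "a \<in> carrier_vec n" and b: "b \<in> carrier_vec n"
    and eq: "M + outer_prod a a = N + outer_prod b b"
  shows "(\<Sum>i<n. \<bar>ds ! i - es ! i\<bar>) \<le> a \<bullet> a + b \<bullet> b"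
    and "\<And>i. Suc i < n \<Longrightarrow> ds ! Suc i \<le> es ! i"
    and "\<And>i. Suc i < n \<Longrightarrow> es ! Suc i \<le> ds ! i"
proof -
  note Mc = diagonalizes_symmetric[OF M(1)] and Nc = diagonalizes_symmetric[OF N(1)]
  let ?K = "M + outer_prod a a"
  have K: "?K \<in> carrier_mat n n" using Mc a by simp
  have "transpose_mat (outer_prod a a) = outer_prod a a"
    by (rule eq_matI) (auto simp: outer_prod_def)
  hence "transpose_mat ?K = ?K" using Mc a by (simp add: transpose_add[of _ n n])
  then obtain fs R where fs: "sorted_wrt (\<ge>) fs" and R: "diagonalizes n R fs ?K"
    using symmetric_char_poly_splits[OF K] symmetric_diagonalizable[OF K] by blast
  note ua = eigenvalues_add_outer_prod[OF M R fs a]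
  note ub = eigenvalues_add_outer_prod[OF N R[unfolded eq] fs b]
  have "(\<Sum>i<n. \<bar>ds ! i - es ! i\<bar>) \<le> (\<Sum>i<n. (fs ! i - ds ! i) + (fs ! i - es ! i))"
    using ua(1) ub(1) by (intro sum_mono) (force simp: abs_le_iff)
  thus "(\<Sum>i<n. \<bar>ds ! i - es ! i\<bar>) \<le> a \<bullet> a + b \<bullet> b"
    unfolding sum.distrib ua(2) ub(2) .
  have form: "x \<bullet> (M *\<^sub>v x) + (a \<bullet> x)\<^sup>2 = x \<bullet> (N *\<^sub>v x) + (b \<bullet> x)\<^sup>2" if "x \<in> carrier_vec n" for x
    using form_add_outer_prod[OF Mc(1) a that] form_add_outer_prod[OF Nc(1) b that] eq by simp
  show "ds ! Suc i \<le> es ! i" if "Suc i < n" for i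
  proof -
    \<comment> \<open>On the hyperplane orthogonal to \<open>b\<close> the forms differ by
      \<open>(a \<bullet> x)^2\<close> in favour of \<open>N\<close>; this one constraint shifts the
      index by one.\<close>
    have "x \<bullet> (M *\<^sub>v x) \<le> x \<bullet> (N *\<^sub>v x)" if "x \<in> carrier_vec n" "b \<bullet> x = 0" for x
    proof -
      have "x \<bullet> (N *\<^sub>v x) = x \<bullet> (M *\<^sub>v x) + (a \<bullet> x)\<^sup>2" using form[OF that(1)] that(2) by simp
      thus ?thesis by simp
    qed
    thus ?thesis
      using eigenvalue_le_of_constrained_form_le[OF M N, of "[b]" i] that b by simp
  qed
  show "es ! Suc i \<le> ds ! i" if "Suc i < n" for i
  proof -
    have "x \<bullet> (N *\<^sub>v x) \<le> x \<bullet> (M *\<^sub>v x)" if "x \<in> carrier_vec n" "a \<bullet> x = 0" for x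
    proof -
      have "x \<bullet> (M *\<^sub>v x) = x \<bullet> (N *\<^sub>v x) + (b \<bullet> x)\<^sup>2" using form[OF that(1)] that(2) by simp
      thus ?thesis by simp
    qed
    thus ?thesis
      using eigenvalue_le_of_constrained_form_le[OF N M, of "[a]" i] that a by simp
  qed
qed

subsection \<open>Singular values and the dilation\<close>

lemma proots_prod_linear_factors:
  fixes es :: "'a :: idom list"
  shows "proots (\<Prod>e\<leftarrow>es. [:- e, 1:]) = mset es"
proof (induction es)
  case (Cons e es)
  have "(\<Prod>e\<leftarrow>es. [:- e, 1:]) \<noteq> 0" by (auto simp: prod_list_zero_iff)
  thus ?case using Cons by (simp add: proots_mult del: mult_pCons_left)
qed simp

lemma gram_form:
  assumes X: "X \<in> carrier_mat m n" and x: "x \<in> carrier_vec n"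
  shows "x \<bullet> ((transpose_mat X * X) *\<^sub>v x) = (X *\<^sub>v x) \<bullet> (X *\<^sub>v (x :: real vec))"
proof -
  have Xx: "X *\<^sub>v x \<in> carrier_vec m" using X x by (intro mult_mat_vec_carrier)
  have "x \<bullet> ((transpose_mat X * X) *\<^sub>v x) = x \<bullet> (transpose_mat X *\<^sub>v (X *\<^sub>v x))"
    using X x by (simp add: assoc_mult_mat_vec[of _ n m _ n])
  also have "\<dots> = (transpose_mat X *\<^sub>v (X *\<^sub>v x)) \<bullet> x"
    using X x Xx by (intro comm_scalar_prod[of _ n]) (auto intro!: mult_mat_vec_carrier[of _ n m])
  also have "\<dots> = (X *\<^sub>v x) \<bullet> (X *\<^sub>v x)"
    using transpose_vec_mult_scalar[OF X x Xx] .
  finally show ?thesis .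
qed

text \<open>All later arguments use \<open>singular_values\<close> only through these facts.
  Comparing \<open>X^T X\<close> with the zero matrix shows that its eigenvalues are nonnegative,
  and that those from index \<open>min m n\<close> on vanish.\<close>

lemma singular_values_spectrum:
  assumes X: "X \<in> carrier_mat m n"
  shows "length (singular_values X) = min m n"
    and "sorted_wrt (\<ge>) (singular_values X)"
    and "\<And>t. t \<in> set (singular_values X) \<Longrightarrow> 0 \<le> t"
    and "char_poly (transpose_mat X * X) =
      (\<Prod>t\<leftarrow>singular_values X @ replicate (n - min m n) 0. [:- t\<^sup>2, 1:])"
    and "\<exists>Q. diagonalizes n Q
      (map (\<lambda>t. t\<^sup>2) (singular_values X @ replicate (n - min m n) 0)) (transpose_mat X * X)"
proof -
  let ?G = "transpose_mat X * X"
  define k where "k = min m n"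
  have G: "?G \<in> carrier_mat n n" using X by simp
  have Gt: "transpose_mat ?G = ?G" using X by (simp add: transpose_mult[of _ n m _ n])
  obtain es where len: "length es = n" and sorted: "sorted_wrt (\<ge>) es"
    and cp: "char_poly ?G = (\<Prod>e\<leftarrow>es. [:- e, 1:])"
    using symmetric_char_poly_splits[OF G Gt] by blast
  obtain Q where Q: "diagonalizes n Q es ?G"
    using symmetric_diagonalizable[OF G Gt cp len] by blast
  have Z: "diagonalizes n (1\<^sub>m n) (replicate n 0) (0\<^sub>m n n)"
    by (auto simp: diagonalizes_def mat_diag_def intro!: eq_matI)
  have Zs: "sorted_wrt (\<ge>) (replicate n (0 :: real))" by (simp add: sorted_wrt_iff_nth_less)
  have form0: "x \<bullet> (0\<^sub>m n n *\<^sub>v x) = 0" if "x \<in> carrier_vec n" for x :: "real vec"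
  proof -
    have "0\<^sub>m n n *\<^sub>v x = 0\<^sub>v n" using that by (intro eq_vecI) auto
    thus ?thesis using that by simp
  qed
  have nonneg: "0 \<le> es ! i" if i: "i < n" for i
  proof -
    have "x \<bullet> (0\<^sub>m n n *\<^sub>v x) \<le> x \<bullet> (?G *\<^sub>v x)" if "x \<in> carrier_vec n" for x
      using conjugate_square_ge_0_vec[of "X *\<^sub>v x"] by (subst gram_form[OF X that]) (simp add: form0[OF that])
    thus ?thesis
      using eigenvalue_le_of_constrained_form_le[OF Z Zs Q sorted, of "[]" i] i by simp
  qed
  have zero: "es ! i = 0" if i: "k \<le> i" "i < n" for i
  proof -
    have m: "m \<le> i" "m < n" using i by (auto simp: k_def)
    \<comment> \<open>Here \<open>m < n\<close>. The \<open>m\<close> rows of \<open>X\<close>,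
      taken as constraints, force \<open>X x = 0\<close>, so the eigenvalue with index
      \<open>m\<close> is at most 0.\<close>
    have "x \<bullet> (?G *\<^sub>v x) \<le> x \<bullet> (0\<^sub>m n n *\<^sub>v x)"
      if x: "x \<in> carrier_vec n" and 0: "\<forall>w \<in> set (rows X). w \<bullet> x = 0" for x
    proof -
      have "X *\<^sub>v x = 0\<^sub>v m" using X 0 by (intro eq_vecI) (auto simp: rows_def)
      thus ?thesis by (simp add: form0[OF x] gram_form[OF X x])
    qed
    hence "es ! (0 + length (rows X)) \<le> replicate n 0 ! 0"
      by (intro eigenvalue_le_of_constrained_form_le[OF Q sorted Z Zs])
        (use X m rows_carrier[of X] in auto)
    hence "es ! m \<le> 0" using X m by simp
    moreover have "es ! i \<le> es ! m"
      using sorted m i len by (cases "i = m") (auto simp: sorted_wrt_iff_nth_less)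
    ultimately show ?thesis using nonneg i by fastforce
  qed
  \<comment> \<open>The definition sorts in ascending order and reverses; \<open>es\<close> is
    descending already, so the two agree.\<close>
  have "sort (map sqrt es) = rev (map sqrt es)"
    by (rule properties_for_sort) (use sorted in \<open>auto simp: sorted_wrt_rev sorted_wrt_map\<close>)
  hence sv: "singular_values X = take k (map sqrt es)"
    using X by (simp add: singular_values_def cp proots_prod_linear_factors k_def
        mset_map[symmetric] del: mset_map)
  have split: "map sqrt es = singular_values X @ replicate (n - k) 0"
  proof -
    have "drop k (map sqrt es) = replicate (n - k) 0"
      by (rule nth_equalityI) (use zero len in auto)
    thus ?thesis using append_take_drop_id[of k "map sqrt es"] sv by simp
  qed
  have es: "es = map (\<lambda>t. t\<^sup>2) (singular_values X @ replicate (n - k) 0)"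
    unfolding split[symmetric] by (rule nth_equalityI) (use nonneg len in auto)
  show "length (singular_values X) = min m n" using len by (simp add: sv k_def)
  show "sorted_wrt (\<ge>) (singular_values X)"
    unfolding sv using sorted by (intro sorted_wrt_take) (simp add: sorted_wrt_map)
  show "0 \<le> t" if "t \<in> set (singular_values X)" for t
    using that nonneg len unfolding sv by (auto simp: in_set_conv_nth)
  show "char_poly ?G = (\<Prod>t\<leftarrow>singular_values X @ replicate (n - min m n) 0. [:- t\<^sup>2, 1:])"
    unfolding cp unfolding k_def[symmetric] by (subst es) (simp add: o_def)
  show "\<exists>Q. diagonalizes n Q
      (map (\<lambda>t. t\<^sup>2) (singular_values X @ replicate (n - min m n) 0)) ?G"
    using Q unfolding k_def[symmetric] es[symmetric] by blast
qed

section \<open>The symmetric dilation and its spectrum\<close>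

text \<open>The Jordan-Wielandt matrix. Unlike \<open>X^T X\<close> it is linear in
  \<open>X\<close>, so a rank-one change of \<open>X\<close> becomes a signed sum of two rank-one
  terms.\<close>

definition dilation :: "real mat \<Rightarrow> real mat" where
  "dilation X = four_block_mat (0\<^sub>m (dim_row X) (dim_row X)) X (transpose_mat X)
     (0\<^sub>m (dim_col X) (dim_col X))"

lemma dilation_symmetric:
  assumes X: "X \<in> carrier_mat m n"
  shows "dilation X \<in> carrier_mat (m + n) (m + n)" and "transpose_mat (dilation X) = dilation X"
  using X by (auto simp: dilation_def transpose_four_block_mat[of _ m m _ n _ n])

text \<open>Lets the substitution of \<open>x^2\<close> for \<open>x\<close> be pulled through a
  determinant.\<close>

lemma pcompose_comm_ring_hom:
  fixes q :: "'a :: comm_ring_1 poly"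
  shows "comm_ring_hom (\<lambda>p. pcompose p q)"
  by unfold_locales (auto simp: pcompose_add pcompose_mult pcompose_1)

text \<open>Multiply \<open>x I - [0, X; X\<^sup>T, 0]\<close> on the right by the block matrix \<open>[I, X; 0, x I]\<close>; the product
  is block lower triangular.\<close>

lemma char_poly_dilation:
  assumes X: "X \<in> carrier_mat m n"
  shows "[:0, 1:] ^ n * char_poly (dilation X) =
    [:0, 1:] ^ m * pcompose (char_poly (transpose_mat X * X)) [:0, 0, 1:]"
proof -
  let ?x = "[:0, 1:] :: real poly" and ?y = "[:0, 0, 1:] :: real poly"
  let ?G = "transpose_mat X * X"
  define C where "C = map_mat (\<lambda>a. [:a:]) X"
  have C: "C \<in> carrier_mat m n" using X by (simp add: C_def)
  define A1 where "A1 = ?x \<cdot>\<^sub>m 1\<^sub>m m"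
  define A4 where "A4 = ?x \<cdot>\<^sub>m 1\<^sub>m n"
  have A: "A1 \<in> carrier_mat m m" "A4 \<in> carrier_mat n n" by (auto simp: A1_def A4_def)
  define F where "F = four_block_mat A1 (- C) (- transpose_mat C) A4"
  define R where "R = four_block_mat (1\<^sub>m m) C (0\<^sub>m n m) A4"
  \<comment> \<open>The lower right block of \<open>F * R\<close>, equal to
    \<open>x^2 I - X^T X\<close>: the characteristic matrix of \<open>X^T X\<close> evaluated at
    \<open>x^2\<close>.\<close>
  define K where "K = - transpose_mat C * C + A4 * A4"
  have G: "?G \<in> carrier_mat n n" using X by simp
  have F: "F \<in> carrier_mat (m + n) (m + n)" and R: "R \<in> carrier_mat (m + n) (m + n)"
    using A C by (auto simp: F_def R_def)
  have K: "K \<in> carrier_mat n n" using A C by (simp add: K_def)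
  have chF: "char_poly (dilation X) = det F"
  proof -
    have "char_poly_matrix (dilation X) = F"
      using X by (intro eq_matI)
        (auto simp: char_poly_matrix_def dilation_def F_def A1_def A4_def C_def one_poly_def)
    thus ?thesis by (simp add: char_poly_def)
  qed
  have "F * R = four_block_mat A1 (0\<^sub>m m n) (- transpose_mat C) K"
  proof -
    have "A1 * C + - C * A4 = 0\<^sub>m m n"
      using C by (auto simp: A1_def A4_def mult_smult_distrib[of _ m n _ n] mult_smult_assoc_mat[of _ m m _ n]
          intro!: eq_matI)
    thus ?thesis unfolding F_def R_def K_def using A C
      by (subst mult_four_block_mat[of _ m m _ n _ n _ _ m _ n]) auto
  qed
  hence "det F * det R = det A1 * det K"
    using det_mult[OF F R] det_four_block_mat_upper_right_zero[OF A(1) refl _ K, of "- transpose_mat C"] C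
    by simp
  moreover have "det R = ?x ^ n"
    unfolding R_def using det_four_block_mat_lower_left_zero[OF _ C refl A(2)] A
    by (simp add: A4_def det_smult)
  moreover have "det A1 = ?x ^ m" by (simp add: A1_def det_smult)
  moreover have "det K = pcompose (char_poly ?G) ?y"
  proof -
    have "K = map_mat (\<lambda>p. pcompose p ?y) (char_poly_matrix ?G)"
    proof (rule eq_matI)
      fix i j assume "i < dim_row (map_mat (\<lambda>p. pcompose p ?y) (char_poly_matrix ?G))"
        "j < dim_col (map_mat (\<lambda>p. pcompose p ?y) (char_poly_matrix ?G))"
      hence ij: "i < n" "j < n" using X by (auto simp: char_poly_matrix_def)
      have "(- transpose_mat C * C) $$ (i, j) = [: - (?G $$ (i, j)) :]"
      proof -
        have "(- transpose_mat C * C) $$ (i, j) = - (\<Sum>k<m. [:X $$ (k, i) * X $$ (k, j):])"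
          using ij X by (simp add: C_def scalar_prod_def atLeast0LessThan sum_negf mult.commute)
        also have "\<dots> = [: - (\<Sum>k<m. X $$ (k, i) * X $$ (k, j)) :]"
          by (induction m) auto
        finally show ?thesis
          using ij X by (simp add: scalar_prod_def atLeast0LessThan)
      qed
      moreover have "(A4 * A4) $$ (i, j) = (if i = j then ?y else 0)"
        using ij by (simp add: A4_def mult_smult_distrib[of _ n n _ n] mult_smult_assoc_mat[of _ n n _ n])
      ultimately show "K $$ (i, j) = map_mat (\<lambda>p. pcompose p ?y) (char_poly_matrix ?G) $$ (i, j)"
        using ij X A C by (simp add: K_def char_poly_matrix_def pcompose_pCons pcompose_add)
    qed (use K X in \<open>auto simp: char_poly_matrix_def\<close>)
    thus ?thesis by (simp add: char_poly_def comm_ring_hom.hom_det[OF pcompose_comm_ring_hom])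
  qed
  ultimately show ?thesis by (simp add: chF mult.commute)
qed

text \<open>The blocks stand in descending order, so the singular values occupy the first
  \<open>min m n\<close> places.\<close>

definition dilation_eigenvalues :: "real mat \<Rightarrow> real list" where
  "dilation_eigenvalues X = singular_values X @
     replicate (dim_row X + dim_col X - 2 * min (dim_row X) (dim_col X)) 0 @
     rev (map uminus (singular_values X))"

text \<open>Substituting \<open>x^2\<close> turns each factor \<open>x - t^2\<close> of the
  characteristic polynomial of \<open>X^T X\<close> into \<open>(x - t) (x + t)\<close>; what
  remains is to count powers of \<open>x\<close>.\<close>

lemma dilation_diagonalizable:
  assumes X: "X \<in> carrier_mat m n"
  shows "sorted_wrt (\<ge>) (dilation_eigenvalues X)"
    and "\<exists>Q. diagonalizes (m + n) Q (dilation_eigenvalues X) (dilation X)"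
proof -
  note sv = singular_values_spectrum[OF X]
  let ?s = "singular_values X"
  show "sorted_wrt (\<ge>) (dilation_eigenvalues X)"
  proof -
    have "sorted_wrt (\<ge>) (replicate r (0 :: real))" for r by (simp add: sorted_wrt_iff_nth_less)
    moreover have "- u \<le> t" if "t \<in> set ?s" "u \<in> set ?s" for t u
      using sv(3)[OF that(1)] sv(3)[OF that(2)] by simp
    ultimately show ?thesis
      using sv(2,3) by (auto simp: dilation_eigenvalues_def sorted_wrt_append sorted_wrt_rev
          sorted_wrt_map)
  qed
  let ?k = "min m n" let ?x = "[:0, 1:] :: real poly"
  define r q where "r = n - ?k" and "q = m + n - 2 * ?k"
  have "[:- t\<^sup>2, 0, 1:] = [:- t, 1:] * [:- (- t), 1:]" for t :: real
    by (simp add: power2_eq_square)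
  hence fac: "(\<Prod>t\<leftarrow>ts. [:- t\<^sup>2, 0, 1:]) = (\<Prod>t\<leftarrow>ts. [:- t, 1:]) * (\<Prod>t\<leftarrow>map uminus ts. [:- t, 1:])"
    for ts :: "real list"
    by (induction ts) (simp_all add: mult_ac del: mult_pCons_left mult_pCons_right)
  have comp: "pcompose (\<Prod>t\<leftarrow>ts. [:- t\<^sup>2, 1:]) [:0, 0, 1:] = (\<Prod>t\<leftarrow>ts. [:- t\<^sup>2, 0, 1:])"
    for ts :: "real list"
    by (induction ts) (simp_all add: pcompose_mult pcompose_pCons pcompose_1 del: mult_pCons_left)
  have "?x ^ n * char_poly (dilation X) =
      ?x ^ m * (\<Prod>t\<leftarrow>?s @ replicate (n - ?k) 0. [:- t\<^sup>2, 0, 1:])"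
    unfolding char_poly_dilation[OF X] sv(4)
    unfolding comp ..
  \<comment> \<open>Each of the \<open>r\<close> padding zeros contributes \<open>x^2\<close>. As
    \<open>m + 2 r = n + q\<close>, cancelling \<open>x^n\<close> leaves \<open>q\<close> zero
    eigenvalues.\<close>
  also have "\<dots> = ?x ^ (m + r + r) * ((\<Prod>t\<leftarrow>?s. [:- t, 1:]) * (\<Prod>t\<leftarrow>map uminus ?s. [:- t, 1:]))"
    unfolding fac r_def[symmetric] by (simp add: power_add mult_ac del: mult_pCons_left mult_pCons_right)
  also have "m + r + r = n + q" by (auto simp: r_def q_def)
  also have "?x ^ \<dots> * ((\<Prod>t\<leftarrow>?s. [:- t, 1:]) * (\<Prod>t\<leftarrow>map uminus ?s. [:- t, 1:]))
      = ?x ^ n * (\<Prod>e\<leftarrow>dilation_eigenvalues X. [:- e, 1:])"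
    using X by (simp add: dilation_eigenvalues_def power_add mult_ac rev_map[symmetric] q_def[symmetric]
        del: mult_pCons_left mult_pCons_right)
  finally have "char_poly (dilation X) = (\<Prod>e\<leftarrow>dilation_eigenvalues X. [:- e, 1:])"
    by (subst (asm) mult_left_cancel) auto
  moreover have "length (dilation_eigenvalues X) = m + n"
    using X sv(1) by (auto simp: dilation_eigenvalues_def)
  ultimately show "\<exists>Q. diagonalizes (m + n) Q (dilation_eigenvalues X) (dilation X)"
    using symmetric_diagonalizable dilation_symmetric[OF X] by blast
qed

text \<open>Each difference occurs once with either sign and the zeros match. The factor 2 later
  cancels against \<open>|a|^2 + |b|^2 = 2 s\<close>.\<close>

lemma sum_lessThan_dilation_eigenvalues:
  assumes X: "X \<in> carrier_mat m n" and Y: "Y \<in> carrier_mat m n"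
  shows "(\<Sum>i<m + n. \<bar>dilation_eigenvalues X ! i - dilation_eigenvalues Y ! i\<bar>) =
    2 * (\<Sum>i<min m n. \<bar>singular_values X ! i - singular_values Y ! i\<bar>)"
proof -
  let ?f = "\<lambda>(x, y). \<bar>x - y :: real\<bar>"
  let ?s = "singular_values X" and ?t = "singular_values Y"
  have l: "length ?s = min m n" "length ?t = min m n"
    using singular_values_spectrum(1) X Y by auto
  have sum: "(\<Sum>i<length xs. \<bar>xs ! i - ys ! i\<bar>) = sum_list (map ?f (zip xs ys))"
    if "length xs = length ys" for xs ys :: "real list"
    using that by (simp add: sum_list_sum_nth atLeast0LessThan)
  have neg: "map ?f (zip (map uminus ?s) (map uminus ?t)) = map ?f (zip ?s ?t)"
    by (simp add: zip_map_map o_def case_prod_unfold abs_minus_commute)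
  have rep: "sum_list (map ?f (zip (replicate r 0) (replicate r 0))) = 0" for r
    by (simp add: zip_replicate sum_list_replicate)
  have "(\<Sum>i<m + n. \<bar>dilation_eigenvalues X ! i - dilation_eigenvalues Y ! i\<bar>)
      = sum_list (map ?f (zip (dilation_eigenvalues X) (dilation_eigenvalues Y)))"
  proof -
    have "length (dilation_eigenvalues X) = m + n" "length (dilation_eigenvalues Y) = m + n"
      using X Y l by (auto simp: dilation_eigenvalues_def)
    thus ?thesis using sum[of "dilation_eigenvalues X" "dilation_eigenvalues Y"] by simp
  qed
  also have "\<dots> = sum_list (map ?f (zip ?s ?t)) + sum_list (map ?f (zip ?s ?t))"
    using X Y l by (simp add: dilation_eigenvalues_def rep zip_rev rev_map[symmetric] neg
        sum_list_replicate)
  also have "\<dots> = 2 * (\<Sum>i<min m n. \<bar>?s ! i - ?t ! i\<bar>)"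
    using sum[of ?s ?t] l by simp
  finally show ?thesis .
qed

text \<open>With \<open>a = (c w, v/(2c))\<close> and \<open>b = (-c w, v/(2c))\<close>, the dilation of \<open>w v\<^sup>T\<close> is \<open>a a\<^sup>T - b b\<^sup>T\<close>;
  the scaling \<open>c\<close> is chosen to make \<open>a\<close> and \<open>b\<close> as short as possible.\<close>

lemma singular_values_rank_one_perturbation:
  assumes X: "X \<in> carrier_mat m n" and w: "w \<in> carrier_vec m" and v: "v \<in> carrier_vec n"
    and vv: "v \<bullet> v = 1"
  defines "Y \<equiv> X + outer_prod w v"
  shows "(\<Sum>i<min m n. \<bar>singular_values X ! i - singular_values Y ! i\<bar>) \<le> sqrt (w \<bullet> w)"
    and "\<And>i. Suc i < min m n \<Longrightarrow> singular_values X ! Suc i \<le> singular_values Y ! i"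
    and "\<And>i. Suc i < min m n \<Longrightarrow> singular_values Y ! Suc i \<le> singular_values X ! i"
proof -
  have Y: "Y \<in> carrier_mat m n" using X w v by (simp add: Y_def)
  define s where "s = sqrt (w \<bullet> w)"
  have l: "length (singular_values X) = min m n" "length (singular_values Y) = min m n"
    using singular_values_spectrum(1) X Y by auto
  have main: "(\<Sum>i<min m n. \<bar>singular_values X ! i - singular_values Y ! i\<bar>) \<le> s \<and>
    (\<forall>i. Suc i < min m n \<longrightarrow> singular_values X ! Suc i \<le> singular_values Y ! i \<and>
       singular_values Y ! Suc i \<le> singular_values X ! i)"
  proof (cases "w = 0\<^sub>v m")
    case True
    have "Y = X" unfolding Y_def True using X v by (intro eq_matI) (auto simp: outer_prod_def)
    thus ?thesis using singular_values_spectrum(2)[OF X] l True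
      by (auto simp: s_def sorted_wrt_iff_nth_less)
  next
    case False
    have ww: "w \<bullet> w > 0" using conjugate_square_greater_0_vec[OF w] False by simp
    hence s: "s > 0" "s * s = w \<bullet> w" by (simp_all add: s_def)
    \<comment> \<open>This \<open>c\<close> balances the two halves: \<open>c^2 |w|^2\<close> and
      \<open>1 / (4 c^2)\<close> both equal \<open>s / 2\<close>, so
      \<open>|a|^2 = |b|^2 = s\<close>.\<close>
    define c where "c = sqrt (1 / (2 * s))"
    have c: "c > 0" "c * c = 1 / (2 * s)" using s by (simp_all add: c_def)
    define a where "a = (c \<cdot>\<^sub>v w) @\<^sub>v ((1 / (2 * c)) \<cdot>\<^sub>v v)"
    define b where "b = (- c \<cdot>\<^sub>v w) @\<^sub>v ((1 / (2 * c)) \<cdot>\<^sub>v v)"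
    have ab: "a \<in> carrier_vec (m + n)" "b \<in> carrier_vec (m + n)"
      using w v by (auto simp: a_def b_def)
    have quarter: "1 / (2 * c) * (1 / (2 * c)) = s / 2"
      using c s by (simp add: field_simps)
    have "c * c * (w \<bullet> w) = s / 2" using s by (simp add: c(2) s(2)[symmetric])
    hence norm: "a \<bullet> a = s" "b \<bullet> b = s"
      using w v quarter by (simp_all add: a_def b_def scalar_prod_append[of _ m _ n] vv mult.assoc[symmetric])
    have eq: "dilation X + outer_prod a a = dilation Y + outer_prod b b"
      using X Y w v c by (intro eq_matI)
        (auto simp: dilation_def Y_def outer_prod_def a_def b_def field_simps)
    note dX = dilation_diagonalizable[OF X] and dY = dilation_diagonalizable[OF Y]
    obtain P Q where "diagonalizes (m + n) P (dilation_eigenvalues X) (dilation X)"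
      "diagonalizes (m + n) Q (dilation_eigenvalues Y) (dilation Y)"
      using dX(2) dY(2) by blast
    note pert = eigenvalues_signed_rank_two_perturbation[OF this(1) dX(1) this(2) dY(1) ab eq]
    have nth: "dilation_eigenvalues X ! i = singular_values X ! i"
      "dilation_eigenvalues Y ! i = singular_values Y ! i" if "i < min m n" for i
      using that l by (simp_all add: dilation_eigenvalues_def nth_append)
    show ?thesis
    proof (intro conjI allI impI)
      show "(\<Sum>i<min m n. \<bar>singular_values X ! i - singular_values Y ! i\<bar>) \<le> s"
        using pert(1) unfolding sum_lessThan_dilation_eigenvalues[OF X Y] norm by simp
    next
      fix i assume i: "Suc i < min m n"
      show "singular_values X ! Suc i \<le> singular_values Y ! i"
        "singular_values Y ! Suc i \<le> singular_values X ! i"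
        using pert(2,3)[of i] i nth[of i] nth[of "Suc i"] by auto
    qed
  qed
  show "(\<Sum>i<min m n. \<bar>singular_values X ! i - singular_values Y ! i\<bar>) \<le> sqrt (w \<bullet> w)"
    using main by (simp add: s_def)
  show "singular_values X ! Suc i \<le> singular_values Y ! i" if "Suc i < min m n" for i
    using main that by blast
  show "singular_values Y ! Suc i \<le> singular_values X ! i" if "Suc i < min m n" for i
    using main that by blast
qed

section \<open>Concave functions on interlacing sequences\<close>

lemma concave_on_increment_le:
  fixes f :: "real \<Rightarrow> real"
  assumes f: "concave_on {0..} f" and "0 \<le> x" "x \<le> y" "0 \<le> d"
  shows "f (y + d) - f y \<le> f (x + d) - f x"
proof (cases "y + d = x")
  case False
  \<comment> \<open>\<open>x + d\<close> and \<open>y\<close> are convex combinations of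
    \<open>x\<close> and \<open>y + d\<close> with the weights \<open>t\<close> and
    \<open>1 - t\<close> exchanged, so adding the two concavity inequalities gives the
    claim.\<close>
  define t where "t = d / (y + d - x)"
  have D: "y + d - x > 0" using assms False by simp
  have t: "0 \<le> t" "t \<le> 1" using assms D by (simp_all add: t_def field_simps)
  have "(1 - t) * x + t * (y + d) = x + t * (y + d - x)" by (simp add: algebra_simps)
  also have "\<dots> = x + d" using D by (simp add: t_def)
  finally have e1: "(1 - t) * x + t * (y + d) = x + d" .
  have e2: "t * x + (1 - t) * (y + d) = y" using e1 by (simp add: algebra_simps)
  have "(1 - t) * f x + t * f (y + d) \<le> f ((1 - t) * x + t * (y + d))"
    using concave_onD[OF f, of t x "y + d"] assms t by simp
  moreover have "t * f x + (1 - t) * f (y + d) \<le> f (t * x + (1 - t) * (y + d))"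
    using concave_onD[OF f, of "1 - t" x "y + d"] assms t by simp
  ultimately have "(1 - t) * f x + t * f (y + d) + (t * f x + (1 - t) * f (y + d)) \<le> f (x + d) + f y"
    unfolding e1 e2 by linarith
  thus ?thesis by (simp add: algebra_simps)
next
  case True
  hence "y = x" "d = 0" using assms by auto
  thus ?thesis by simp
qed

text \<open>By concavity a drop over one step of length \<open>d\<close> is repeated, at least as
  large, over every further step, which would finally make \<open>f\<close> negative.\<close>

lemma nonneg_concave_mono:
  fixes f :: "real \<Rightarrow> real"
  assumes f: "concave_on {0..} f" and nn: "f \<in> {0..} \<rightarrow> {0..}" and xy: "0 \<le> x" "x \<le> y"
  shows "f x \<le> f y"
proof (rule ccontr)
  assume "\<not> f x \<le> f y"
  define d where "d = y - x"
  have d: "0 \<le> d" and neg: "f x - f (x + d) > 0"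
    using xy \<open>\<not> f x \<le> f y\<close> by (simp_all add: d_def)
  have "f (x + real k * d) \<le> f x - real k * (f x - f (x + d))" for k
  proof (induction k)
    case (Suc k)
    have "f (x + real k * d + d) - f (x + real k * d) \<le> f (x + d) - f x"
      using d xy by (intro concave_on_increment_le[OF f]) auto
    thus ?case using Suc by (simp add: algebra_simps)
  qed simp
  moreover obtain k where "f x < real k * (f x - f (x + d))"
    using reals_Archimedean3[OF neg] by blast
  moreover have "f (x + real k * d) \<ge> 0" for k using nn xy d by auto
  ultimately show False by (meson diff_less_0_iff_less not_le order.strict_trans2 order_trans le_less_trans)
qed

text \<open>The intervals between \<open>a i\<close> and \<open>b i\<close> do not overlap. Stacking them one after the other
  from \<open>0\<close> moves each to the left, which by concavity only increases the increment of \<open>f\<close>.\<close>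

lemma sum_abs_concave_interlacing:
  fixes f :: "real \<Rightarrow> real"
  assumes f: "concave_on {0..} f" and f0: "f 0 = 0"
    and "\<And>i. i < k \<Longrightarrow> 0 \<le> a i" "\<And>i. i < k \<Longrightarrow> 0 \<le> b i"
    and mono: "\<And>x y. 0 \<le> x \<Longrightarrow> x \<le> y \<Longrightarrow> f x \<le> f y"
    and "\<And>i. Suc i < k \<Longrightarrow> max (a (Suc i)) (b (Suc i)) \<le> min (a i) (b i)"
  shows "(\<Sum>i<k. \<bar>f (a i) - f (b i)\<bar>) \<le> f (\<Sum>i<k. \<bar>a i - b i\<bar>)
    \<and> (0 < k \<longrightarrow> (\<Sum>i<k. \<bar>a i - b i\<bar>) \<le> max (a 0) (b 0))"
  using assms(3,4,6)
proof (induction k arbitrary: a b)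
  case (Suc k)
  define T where "T = (\<Sum>i<k. \<bar>a (Suc i) - b (Suc i)\<bar>)"
  have IH: "(\<Sum>i<k. \<bar>f (a (Suc i)) - f (b (Suc i))\<bar>) \<le> f T"
    "0 < k \<Longrightarrow> T \<le> max (a (Suc 0)) (b (Suc 0))"
    unfolding T_def using Suc.IH[of "\<lambda>i. a (Suc i)" "\<lambda>i. b (Suc i)"] Suc.prems by auto
  define lo hi where "lo = min (a 0) (b 0)" and "hi = max (a 0) (b 0)"
  have lo: "0 \<le> lo" "lo \<le> hi" using Suc.prems(1,2)[of 0] by (auto simp: lo_def hi_def)
  have d: "\<bar>a 0 - b 0\<bar> = hi - lo" by (auto simp: lo_def hi_def)
  have T0: "0 \<le> T" by (simp add: T_def sum_nonneg)
  \<comment> \<open>The second conjunct serves this step: the lower intervals have total length at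
    most their top endpoint, which is at most \<open>lo\<close>. So the topmost interval, index 0,
    can slide left to start at \<open>T\<close>.\<close>
  have Tlo: "T \<le> lo"
  proof (cases "k = 0")
    case True thus ?thesis using lo by (simp add: T_def)
  next
    case False
    thus ?thesis using IH(2) Suc.prems(3)[of 0] by (auto simp: lo_def max_def split: if_splits)
  qed
  have "\<bar>f (a 0) - f (b 0)\<bar> = f hi - f lo"
    using mono[of "a 0" "b 0"] mono[of "b 0" "a 0"] Suc.prems(1,2)[of 0]
    by (cases "a 0 \<le> b 0") (auto simp: lo_def hi_def max_def min_def)
  also have "\<dots> \<le> f (T + (hi - lo)) - f T"
    using concave_on_increment_le[OF f T0 Tlo, of "hi - lo"] lo by simp
  finally have "\<bar>f (a 0) - f (b 0)\<bar> + (\<Sum>i<k. \<bar>f (a (Suc i)) - f (b (Suc i))\<bar>) \<le> f (T + (hi - lo))"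
    using IH(1) by simp
  thus ?case using Tlo
    unfolding sum.lessThan_Suc_shift T_def[symmetric] d hi_def[symmetric]
    by (simp add: add.commute)
qed (simp add: f0)

subsection \<open>Rank-one decomposition and telescoping\<close>

text \<open>A singular value decomposition without left singular vectors: \<open>v p\<close> are
  orthonormal eigenvectors of \<open>C^T C\<close> and \<open>w p = C v p\<close>, so no division by
  a singular value occurs. All \<open>n\<close> eigenvectors enter, hence the padding by
  zeros.\<close>

lemma singular_values_rank_one_decomposition:
  assumes C: "C \<in> carrier_mat m n"
  shows "\<exists>w v. (\<forall>p<n. w p \<in> carrier_vec m \<and> v p \<in> carrier_vec n \<and> v p \<bullet> v p = 1 \<and>
      sqrt (w p \<bullet> w p) = (singular_values C @ replicate (n - min m n) 0) ! p) \<and>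
    (\<forall>i<m. \<forall>j<n. C $$ (i, j) = (\<Sum>p<n. w p $ i * v p $ j))"
proof -
  define \<tau> where "\<tau> = singular_values C @ replicate (n - min m n) 0"
  obtain Q where Q: "diagonalizes n Q (map (\<lambda>t. t\<^sup>2) \<tau>) (transpose_mat C * C)"
    using singular_values_spectrum(5)[OF C] unfolding \<tau>_def by blast
  hence Qc: "Q \<in> carrier_mat n n" and QQ: "transpose_mat Q * Q = 1\<^sub>m n"
    and QQ': "Q * transpose_mat Q = 1\<^sub>m n" and len: "length \<tau> = n"
    by (auto simp: diagonalizes_def)
  define v w where "v = col Q" and "w p = C *\<^sub>v v p" for p
  have v: "v p \<in> carrier_vec n" if "p < n" for p using Qc that by (auto simp: v_def)
  have w: "w p \<in> carrier_vec m" if "p < n" for p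
    unfolding w_def using C v[OF that] by (rule mult_mat_vec_carrier)
  have orth: "v p \<bullet> v q = (if p = q then 1 else 0)" if "p < n" "q < n" for p q
    using arg_cong[OF QQ, of "\<lambda>M. M $$ (p, q)"] that Qc by (simp add: v_def)
  have norm: "sqrt (w p \<bullet> w p) = \<tau> ! p" if p: "p < n" for p
  proof -
    have "w p \<bullet> w p = (\<Sum>i<n. (\<tau> ! i)\<^sup>2 * (v i \<bullet> v p)\<^sup>2)"
      using diagonalizes_sum_squares(1)[OF Q v[OF p]] gram_form[OF C v[OF p]] len
      by (simp add: w_def v_def)
    also have "\<dots> = (\<Sum>i<n. if i = p then (\<tau> ! p)\<^sup>2 else 0)"
      using p by (intro sum.cong) (auto simp: orth)
    finally have "w p \<bullet> w p = (\<tau> ! p)\<^sup>2" using p by simp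
    moreover have "0 \<le> t" if "t \<in> set \<tau>" for t
      using that singular_values_spectrum(3)[OF C] by (auto simp: \<tau>_def)
    ultimately show ?thesis using len p by simp
  qed
  have "C $$ (i, j) = (\<Sum>p<n. w p $ i * v p $ j)" if ij: "i < m" "j < n" for i j
  proof -
    define W where "W = C * Q"
    have W: "W \<in> carrier_mat m n" using C Qc by (simp add: W_def)
    \<comment> \<open>Expanding \<open>C = (C Q) Q^T\<close> by columns of \<open>C Q\<close> and
      \<open>Q\<close> is the sum of the \<open>w p v p^T\<close>.\<close>
    have "C = W * transpose_mat Q"
      using C Qc QQ' by (simp add: W_def assoc_mult_mat[of _ m n _ n _ n])
    hence "C $$ (i, j) = (W * transpose_mat Q) $$ (i, j)" by simp
    also have "\<dots> = (\<Sum>p<n. W $$ (i, p) * Q $$ (j, p))"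
      using W Qc ij by (simp add: scalar_prod_def atLeast0LessThan)
    also have "\<dots> = (\<Sum>p<n. w p $ i * v p $ j)"
      using C Qc ij by (intro sum.cong) (auto simp: W_def w_def v_def)
    finally show ?thesis .
  qed
  thus ?thesis using v w orth norm unfolding \<tau>_def by (intro exI[of _ w] exI[of _ v]) auto
qed

text \<open>One step of the walk: interlacing bounds the sum by \<open>f\<close> of the total
  length, and monotonicity of \<open>f\<close> replaces that length by the norm of
  \<open>w\<close>.\<close>

lemma sum_abs_concave_singular_values_rank_one:
  assumes X: "X \<in> carrier_mat m n" and w: "w \<in> carrier_vec m" and v: "v \<in> carrier_vec n"
    and vv: "v \<bullet> v = 1"
    and f: "concave_on {0..} f" "f \<in> {0..} \<rightarrow> {0..}" "f 0 = 0"
  defines "Y \<equiv> X + outer_prod w v"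
  shows "(\<Sum>i<min m n. \<bar>f (singular_values X ! i) - f (singular_values Y ! i)\<bar>) \<le> f (sqrt (w \<bullet> w))"
proof -
  have Y: "Y \<in> carrier_mat m n" using X w v by (simp add: Y_def)
  note pert = singular_values_rank_one_perturbation[OF X w v vv, folded Y_def]
  note svX = singular_values_spectrum[OF X] and svY = singular_values_spectrum[OF Y]
  have mono: "f x \<le> f y" if "0 \<le> x" "x \<le> y" for x y
    using nonneg_concave_mono[OF f(1,2) that] .
  have "(\<Sum>i<min m n. \<bar>f (singular_values X ! i) - f (singular_values Y ! i)\<bar>)
      \<le> f (\<Sum>i<min m n. \<bar>singular_values X ! i - singular_values Y ! i\<bar>)"
  proof (rule conjunct1[OF sum_abs_concave_interlacing[OF f(1,3)]])
    show "max (singular_values X ! Suc i) (singular_values Y ! Suc i)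
        \<le> min (singular_values X ! i) (singular_values Y ! i)" if "Suc i < min m n" for i
      using pert(2,3)[OF that] svX(1,2) svY(1,2) that by (auto simp: sorted_wrt_iff_nth_less)
  qed (use svX(1,3) svY(1,3) mono in auto)
  also have "\<dots> \<le> f (sqrt (w \<bullet> w))" using pert(1) by (intro mono) (auto simp: sum_nonneg)
  finally show ?thesis .
qed

theorem theorem1:
  fixes m n :: nat and A B :: "real mat" and f :: "real \<Rightarrow> real"
  assumes "m \<ge> 1" and "n \<ge> 1"
    and "A \<in> carrier_mat m n" and "B \<in> carrier_mat m n"
    and "f \<in> {0..} \<rightarrow> {0..}"
    and "concave_on {0..} f"
    and "f 0 = 0"
  shows "(\<Sum>i = 1..min m n. \<bar>f (singular_value i A) - f (singular_value i B)\<bar>)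
       \<le> (\<Sum>i = 1..min m n. f (singular_value i (A - B)))"
proof -
  note A = assms(3) and B = assms(4) and f = assms(6,5,7)
  let ?k = "min m n" and ?s = singular_values
  have C: "A - B \<in> carrier_mat m n" using B by (rule minus_carrier_mat)
  define \<tau> where "\<tau> = ?s (A - B) @ replicate (n - ?k) 0"
  have len: "length (?s (A - B)) = ?k" by (rule singular_values_spectrum(1)[OF C])
  obtain w v where wv: "\<And>p. p < n \<Longrightarrow> w p \<in> carrier_vec m" "\<And>p. p < n \<Longrightarrow> v p \<in> carrier_vec n"
      "\<And>p. p < n \<Longrightarrow> v p \<bullet> v p = 1" "\<And>p. p < n \<Longrightarrow> sqrt (w p \<bullet> w p) = \<tau> ! p"
    and AB: "\<And>i j. i < m \<Longrightarrow> j < n \<Longrightarrow> (A - B) $$ (i, j) = (\<Sum>p<n. w p $ i * v p $ j)"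
    using singular_values_rank_one_decomposition[OF C] unfolding \<tau>_def by blast
  \<comment> \<open>The walk from \<open>Y 0 = B\<close> to \<open>Y n = A\<close>, one rank-one
    term at a time.\<close>
  define Y where "Y l = mat m n (\<lambda>(i, j). B $$ (i, j) + (\<Sum>p<l. w p $ i * v p $ j))" for l
  have Y: "Y l \<in> carrier_mat m n" for l by (simp add: Y_def)
  have "(\<Sum>i<?k. \<bar>f (?s B ! i) - f (?s (Y l) ! i)\<bar>) \<le> (\<Sum>p<l. f (\<tau> ! p))" if "l \<le> n" for l
    using that
  proof (induction l)
    case 0
    have "Y 0 = B" using B by (intro eq_matI) (auto simp: Y_def)
    thus ?case by simp
  next
    case (Suc l)
    hence l: "l < n" by simp
    have YS: "Y (Suc l) = Y l + outer_prod (w l) (v l)"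
      using wv(1,2)[OF l] by (intro eq_matI) (auto simp: Y_def outer_prod_def)
    \<comment> \<open>Triangle inequality through \<open>Y l\<close>; the new step costs
      \<open>f (\<tau> ! l)\<close>.\<close>
    have "(\<Sum>i<?k. \<bar>f (?s B ! i) - f (?s (Y (Suc l)) ! i)\<bar>)
        \<le> (\<Sum>i<?k. \<bar>f (?s B ! i) - f (?s (Y l) ! i)\<bar> + \<bar>f (?s (Y l) ! i) - f (?s (Y (Suc l)) ! i)\<bar>)"
      by (intro sum_mono) linarith
    also have "\<dots> \<le> (\<Sum>p<l. f (\<tau> ! p)) + f (\<tau> ! l)"
      unfolding sum.distrib YS using Suc.IH l
      by (intro add_mono)
        (auto simp flip: wv(4)[OF l] intro: sum_abs_concave_singular_values_rank_one[OF Y wv(1-3)[OF l] f])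
    finally show ?case by simp
  qed
  moreover have "Y n = A"
  proof (rule eq_matI)
    fix i j assume "i < dim_row A" "j < dim_col A"
    hence ij: "i < m" "j < n" using A by auto
    thus "Y n $$ (i, j) = A $$ (i, j)" using AB[OF ij, symmetric] A B by (simp add: Y_def)
  qed (use A in \<open>auto simp: Y_def\<close>)
  moreover have "(\<Sum>p<n. f (\<tau> ! p)) = (\<Sum>p<?k. f (?s (A - B) ! p))"
  proof -
    have "(\<Sum>p<?k. f (?s (A - B) ! p)) = (\<Sum>p<?k. f (\<tau> ! p))"
      by (simp add: \<tau>_def nth_append len)
    \<comment> \<open>The padded entries contribute \<open>f 0 = 0\<close>.\<close>
    also have "\<dots> = (\<Sum>p<n. f (\<tau> ! p))"
      by (rule sum.mono_neutral_left) (auto simp: \<tau>_def nth_append len f)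
    finally show ?thesis by simp
  qed
  ultimately have "(\<Sum>i<?k. \<bar>f (?s A ! i) - f (?s B ! i)\<bar>) \<le> (\<Sum>p<?k. f (?s (A - B) ! p))"
    by (metis (no_types, lifting) abs_minus_commute order_refl sum.cong)
  thus ?thesis by (simp add: singular_value_def sum.atLeast1_atMost_eq)
qed

end
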